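(* For any $E0L$ system $G$, there exists a uniformly fuzzy $0L$ system $FG$ such that $L(G)=L(FG,E_f\le 0)$. Hence $\mathcal{L}(E0L)\subseteq\mathcal{L}(BFEL)$.
   Context: An $E0L$ system is $G=(\Sigma,h,\omega,\Delta)$ with $\Sigma$ a finite alphabet, $h$ a finite substitution on $\Sigma$ (a finite set of productions $a\rightarrow u$), $\omega\in\Sigma^*$, $\Delta\subseteq\Sigma$; $L(G)=\bigcup_{i\ge0}h^i(\omega)\cap\Delta^*$, and $\mathcal{L}(E0L)$ is the class of such languages. A fuzzy $0L$ system is $FG=(\Sigma,\widetilde{h},\omega,J,f)$ where each production $a\rightarrow u$ of the finite substitution $h$ has a label $r\in J$ and a grade $f(r)\in[0,1]$, written $(r)\,a\rightarrow u\ f(r)\in\widetilde{h}$. For $b\in\Sigma$, $R_b$ is the set of labels of productions with left-hand side $b$, and $d(b)=\#R_b$ is the degree of $b$. For $a\in\Sigma$, $r\in R_a$, set $\mu(r)=f(r)/\sum_{r_i\in R_a}f(r_i)$. $FG$ is a uniformly fuzzy $0L$ system if $\mu(r)=1/d(a)$ for all $a\in\Sigma$, $r\in R_a$. For $w=a_1\cdots a_m\in\Sigma^*$, $A_w=\{\pi_1\cdots\pi_m\in J^*\mid (\pi_i)\,a_i\rightarrow u_i\ f(\pi_i)\in\widetilde{h},\ 1\le i\le m\}$, and $\mu$ is extended to label strings multiplicatively, $\mu(\pi\alpha)=\mu(\pi)\mu(\alpha)$ for $\pi\in J$, $\alpha\in J^*$. The fuzzy entropy is $E_f(\Lambda)=0$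 and $E_f(w)=-\sum_{\alpha\in A_w}\mu(\alpha)\log_2\mu(\alpha)$. For $c\ge0$, $L(FG,E_f\le c)=\{w\in\bigcup_{i\ge0}h^i(\omega)\mid E_f(w)\le c\}$ is a bounded fuzzy entropy language, and $\mathcal{L}(BFEL)$ is the class of all such languages (over all fuzzy $0L$ systems $FG$ and constants $c\ge0$). *)

theory Defs
  imports Complex_Main "HOL-Library.Infinite_Typeclass"
begin

text \<open>Words are lists. Alphabets are finite sets of symbols taken from a symbol type, which is
  infinite wherever a construction may need symbols outside a given alphabet.\<close>

definition subst_word :: "('a \<Rightarrow> 'a list set) \<Rightarrow> 'a list \<Rightarrow> 'a list set" where
  "subst_word h w = {concat us | us. list_all2 (\<lambda>a u. u \<in> h a) w us}"

definition subst_lang :: "('a \<Rightarrow> 'a list set) \<Rightarrow> 'a list set \<Rightarrow> 'a list set" where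
  "subst_lang h L = (\<Union>w\<in>L. subst_word h w)"

definition derivable :: "('a \<Rightarrow> 'a list set) \<Rightarrow> 'a list \<Rightarrow> 'a list set" where
  "derivable h w = (\<Union>i::nat. (subst_lang h ^^ i) {w})"

text \<open>A finite substitution assigns to every symbol of the alphabet a finite, nonempty set of
  words; its values outside the alphabet are irrelevant.\<close>

definition finite_substitution :: "'a set \<Rightarrow> ('a \<Rightarrow> 'a list set) \<Rightarrow> bool" where
  "finite_substitution A h \<longleftrightarrow>
     finite A \<and> (\<forall>a\<in>A. finite (h a) \<and> h a \<noteq> {} \<and> h a \<subseteq> lists A)"

record 'a e0l =
  e_alph :: "'a set"
  e_subst :: "'a \<Rightarrow> 'a list set"
  e_start :: "'a list"
  e_term :: "'a set"

definition e0l_system :: "'a e0l \<Rightarrow> bool" where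
  "e0l_system G \<longleftrightarrow>
     finite_substitution (e_alph G) (e_subst G) \<and>
     e_start G \<in> lists (e_alph G) \<and> e_term G \<subseteq> e_alph G"

definition e0l_lang :: "'a e0l \<Rightarrow> 'a list set" where
  "e0l_lang G = derivable (e_subst G) (e_start G) \<inter> lists (e_term G)"

definition E0L :: "'a list set set" where
  "E0L = {e0l_lang G | G. e0l_system G}"

text \<open>In a fuzzy 0L system, \<open>f_prod FG r = (a, u)\<close> together with \<open>f_grade FG r\<close> encodes the
  labelled production \<open>(r) a \<rightarrow> u f(r)\<close>, for \<open>r\<close> in \<open>f_labels FG\<close>. The underlying substitution is
  obtained by forgetting labels and grades.\<close>

record ('a, 'l) fuzzy0l =
  f_alph :: "'a set"
  f_prod :: "'l \<Rightarrow> 'a \<times> 'a list"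
  f_start :: "'a list"
  f_labels :: "'l set"
  f_grade :: "'l \<Rightarrow> real"

definition f_subst :: "('a, 'l) fuzzy0l \<Rightarrow> 'a \<Rightarrow> 'a list set" where
  "f_subst FG a = {u. \<exists>r\<in>f_labels FG. f_prod FG r = (a, u)}"

definition labels_of :: "('a, 'l) fuzzy0l \<Rightarrow> 'a \<Rightarrow> 'l set" where
  "labels_of FG b = {r \<in> f_labels FG. fst (f_prod FG r) = b}"

definition degree_of :: "('a, 'l) fuzzy0l \<Rightarrow> 'a \<Rightarrow> nat" where
  "degree_of FG b = card (labels_of FG b)"

text \<open>Injectivity says that each production carries exactly one label. The last conjunct is what
  makes the quotient in \<open>mu\<close> below well defined.\<close>

definition fuzzy0l_system :: "('a, 'l) fuzzy0l \<Rightarrow> bool" where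
  "fuzzy0l_system FG \<longleftrightarrow>
     finite_substitution (f_alph FG) (f_subst FG) \<and>
     f_start FG \<in> lists (f_alph FG) \<and>
     finite (f_labels FG) \<and>
     inj_on (f_prod FG) (f_labels FG) \<and>
     (\<forall>r\<in>f_labels FG. fst (f_prod FG r) \<in> f_alph FG) \<and>
     (\<forall>r\<in>f_labels FG. 0 \<le> f_grade FG r \<and> f_grade FG r \<le> 1) \<and>
     (\<forall>a\<in>f_alph FG. (\<Sum>r\<in>labels_of FG a. f_grade FG r) > 0)"

definition mu :: "('a, 'l) fuzzy0l \<Rightarrow> 'l \<Rightarrow> real" where
  "mu FG r = f_grade FG r / (\<Sum>s\<in>labels_of FG (fst (f_prod FG r)). f_grade FG s)"

definition uniformly_fuzzy0l_system :: "('a, 'l) fuzzy0l \<Rightarrow> bool" where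
  "uniformly_fuzzy0l_system FG \<longleftrightarrow>
     fuzzy0l_system FG \<and>
     (\<forall>a\<in>f_alph FG. \<forall>r\<in>labels_of FG a. mu FG r = 1 / real (degree_of FG a))"

definition mu_word :: "('a, 'l) fuzzy0l \<Rightarrow> 'l list \<Rightarrow> real" where
  "mu_word FG \<alpha> = prod_list (map (mu FG) \<alpha>)"

definition label_words :: "('a, 'l) fuzzy0l \<Rightarrow> 'a list \<Rightarrow> 'l list set" where
  "label_words FG w = {\<alpha>. list_all2 (\<lambda>a r. r \<in> labels_of FG a) w \<alpha>}"

text \<open>The convention \<open>0 \<cdot> log 0 = 0\<close> for grades equal to zero holds automatically.\<close>

definition fuzzy_entropy :: "('a, 'l) fuzzy0l \<Rightarrow> 'a list \<Rightarrow> real" where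
  "fuzzy_entropy FG w =
     (if w = [] then 0
      else - (\<Sum>\<alpha>\<in>label_words FG w. mu_word FG \<alpha> * log 2 (mu_word FG \<alpha>)))"

definition bounded_entropy_lang :: "('a, 'l) fuzzy0l \<Rightarrow> real \<Rightarrow> 'a list set" where
  "bounded_entropy_lang FG c =
     {w \<in> derivable (f_subst FG) (f_start FG). fuzzy_entropy FG w \<le> c}"

text \<open>Label sets are finite, so drawing labels from the natural numbers loses no generality.\<close>

definition BFEL :: "'a list set set" where
  "BFEL = {bounded_entropy_lang FG c | (FG :: ('a, nat) fuzzy0l) c. fuzzy0l_system FG \<and> 0 \<le> c}"

end

theory Submission imports Defs begin

text \<open>In a uniformly fuzzy system a nonempty word has entropy 0 iff all its letters have degree 1.
  So a given E0L system has to be simulated such that exactly the terminals have degree 1. Take a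
  fresh copy \<open>br a\<close> of every letter \<open>a\<close>, a fresh start symbol \<open>S\<close> and a fresh trap symbol \<open>F\<close>. The
  copies simulate the original derivation, and at any step each of them may rewrite to the terminal
  version of its image instead; a terminal can only be rewritten to \<open>F\<close>, so words over the terminals
  arise only if all copies switch in the same step. The trap is never erased, and it
  serves as the additional alternative that makes the degree of every nonterminal at least 2.\<close>

section \<open>Derivations\<close>

lemma subst_word_Nil [simp]: "subst_word h [] = {[]}"
  by (auto simp: subst_word_def)

text \<open>Letterwise recursion, the form in which the inductions over words use
  \<open>subst_word\<close>.\<close>

lemma subst_word_Cons: "subst_word h (a # w) = {u @ v | u v. u \<in> h a \<and> v \<in> subst_word h w}"
proof (intro set_eqI iffI)
  fix x assume "x \<in> subst_word h (a # w)"
  then obtain u us where "x = u @ concat us" "u \<in> h a" "list_all2 (\<lambda>a u. u \<in> h a) w us"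
    by (auto simp: subst_word_def list_all2_Cons1)
  then show "x \<in> {u @ v | u v. u \<in> h a \<and> v \<in> subst_word h w}"
    unfolding subst_word_def by blast
next
  fix x assume "x \<in> {u @ v | u v. u \<in> h a \<and> v \<in> subst_word h w}"
  then obtain u us where "x = u @ concat us" "u \<in> h a" "list_all2 (\<lambda>a u. u \<in> h a) w us"
    by (auto simp: subst_word_def)
  then have "x = concat (u # us)" "list_all2 (\<lambda>a u. u \<in> h a) (a # w) (u # us)"
    by simp_all
  then show "x \<in> subst_word h (a # w)"
    unfolding subst_word_def by blast
qed

lemma subst_word_single [simp]: "subst_word h [a] = h a"
  by (auto simp: subst_word_Cons)

lemma subst_word_in_lists:
  assumes "finite_substitution A h" "w \<in> lists A" "v \<in> subst_word h w"
  shows "v \<in> lists A"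
  using assms(2,3)
proof (induction w arbitrary: v rule: list.induct)
  case (Cons a w)
  then obtain x y where xy: "v = x @ y" "x \<in> h a" "y \<in> subst_word h w"
    by (auto simp: subst_word_Cons)
  moreover have "x \<in> lists A"
    using assms(1) Cons.prems(1) xy(2) unfolding finite_substitution_def by auto
  ultimately show ?case
    using Cons by auto
qed simp

lemma funpow_subst_lang_Suc:
  "(subst_lang h ^^ Suc i) L = (\<Union>v\<in>(subst_lang h ^^ i) L. subst_word h v)"
  by (simp add: subst_lang_def[of h "(subst_lang h ^^ i) L"])

lemma derivable_refl: "w \<in> derivable h w"
  unfolding derivable_def by (rule UN_I[of 0]) simp_all

lemma derivable_step:
  assumes "v \<in> derivable h w" "u \<in> subst_word h v"
  shows "u \<in> derivable h w"
proof -
  obtain i where "v \<in> (subst_lang h ^^ i) {w}"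
    using assms(1) by (auto simp: derivable_def)
  then have "u \<in> (subst_lang h ^^ Suc i) {w}"
    using assms(2) unfolding funpow_subst_lang_Suc by blast
  then show ?thesis
    unfolding derivable_def by (rule UN_I[OF UNIV_I])
qed

text \<open>Hides the step count of the iterates. Derivability of \<open>v\<close> is kept in the
  step case so that \<open>derivable_in_lists\<close> applies there.\<close>

lemma derivable_induct [consumes 1, case_names refl step]:
  assumes "v \<in> derivable h w"
    and "P w"
    and "\<And>v u. v \<in> derivable h w \<Longrightarrow> P v \<Longrightarrow> u \<in> subst_word h v \<Longrightarrow> P u"
  shows "P v"
proof -
  have "\<forall>v\<in>(subst_lang h ^^ i) {w}. P v" for i
  proof (induction i)
    case (Suc i)
    show ?case
      unfolding funpow_subst_lang_Suc
    proof (intro ballI, elim UN_E)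
      fix v u assume v: "v \<in> (subst_lang h ^^ i) {w}" and u: "u \<in> subst_word h v"
      have "v \<in> derivable h w"
        using v unfolding derivable_def by (rule UN_I[OF UNIV_I])
      then show "P u"
        using Suc v u assms(3) by blast
    qed
  qed (use assms(2) in simp)
  then show ?thesis
    using assms(1) by (auto simp: derivable_def)
qed

lemma derivable_in_lists:
  assumes "finite_substitution A h" "w \<in> lists A" "v \<in> derivable h w"
  shows "v \<in> lists A"
  using assms(3)
proof (induction rule: derivable_induct)
  case (step v u)
  then show ?case
    using subst_word_in_lists[OF assms(1)] by blast
qed (rule assms(2))

section \<open>Entropy in uniformly fuzzy systems\<close>

lemma label_words_finite:
  assumes "finite (f_labels FG)"
  shows "finite (label_words FG w)"
proof (rule finite_subset)
  show "label_words FG w \<subseteq> {\<alpha>. set \<alpha> \<subseteq> f_labels FG \<and> length \<alpha> = length w}"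
    by (fastforce simp: label_words_def labels_of_def list_all2_conv_all_nth in_set_conv_nth)
  show "finite {\<alpha>. set \<alpha> \<subseteq> f_labels FG \<and> length \<alpha> = length w}"
    by (rule finite_lists_length_eq[OF assms])
qed

text \<open>Rules out an empty entropy sum, which would be 0 whatever the degrees are.\<close>

lemma label_words_nonempty:
  assumes "\<And>a. a \<in> set w \<Longrightarrow> labels_of FG a \<noteq> {}"
  shows "label_words FG w \<noteq> {}"
proof -
  have "list_all2 (\<lambda>a r. r \<in> labels_of FG a) w (map (\<lambda>a. SOME r. r \<in> labels_of FG a) w)"
    using assms by (auto simp: list_all2_map2 some_in_eq intro: list_all2_refl list.rel_refl_strong)
  then show ?thesis
    by (auto simp: label_words_def)
qed

text \<open>An empty set of labels would make the sum of grades 0 instead of positive.\<close>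

lemma degree_of_pos:
  assumes "fuzzy0l_system FG" "a \<in> f_alph FG"
  shows "degree_of FG a > 0"
proof -
  have "(\<Sum>r\<in>labels_of FG a. f_grade FG r) > 0"
    using assms by (auto simp: fuzzy0l_system_def)
  then have "labels_of FG a \<noteq> {}"
    by auto
  moreover have "finite (labels_of FG a)"
    using assms(1) by (auto simp: fuzzy0l_system_def labels_of_def)
  ultimately show ?thesis
    by (simp add: degree_of_def card_gt_0_iff)
qed

text \<open>Each label contributes the reciprocal degree of its letter, so the weight depends on
  \<open>w\<close> only and all terms of the entropy sum coincide.\<close>

lemma mu_word_uniform:
  assumes "uniformly_fuzzy0l_system FG" "w \<in> lists (f_alph FG)" "\<alpha> \<in> label_words FG w"
  shows "mu_word FG \<alpha> = (\<Prod>a\<leftarrow>w. 1 / real (degree_of FG a))"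
proof -
  have "list_all2 (\<lambda>a r. r \<in> labels_of FG a) w \<alpha>"
    using assms(3) by (simp add: label_words_def)
  then show ?thesis
    using assms(2)
  proof (induction rule: list_all2_induct)
    case (Cons a w r \<alpha>)
    then show ?case
      using assms(1) by (auto simp: mu_word_def uniformly_fuzzy0l_system_def)
  qed (simp add: mu_word_def)
qed

text \<open>The product is the reciprocal of a product of positive naturals, and such a product is 1
  only if every factor is.\<close>

lemma prod_list_inverse_degree:
  assumes "\<And>a. a \<in> set w \<Longrightarrow> d a > (0::nat)"
  shows "0 < (\<Prod>a\<leftarrow>w. 1 / real (d a))"
    and "(\<Prod>a\<leftarrow>w. 1 / real (d a)) \<le> 1"
    and "(\<Prod>a\<leftarrow>w. 1 / real (d a)) = 1 \<longleftrightarrow> (\<forall>a\<in>set w. d a = 1)"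
proof -
  have "(\<Prod>a\<leftarrow>w. 1 / real (d a)) = 1 / real (\<Prod>a\<leftarrow>w. d a)"
    by (induction w) auto
  moreover have "(\<Prod>a\<leftarrow>w. d a) > 0"
    using assms by (induction w) auto
  moreover have "(\<Prod>a\<leftarrow>w. d a) = 1 \<longleftrightarrow> (\<forall>a\<in>set w. d a = 1)"
    by (induction w) auto
  ultimately show "0 < (\<Prod>a\<leftarrow>w. 1 / real (d a))"
    and "(\<Prod>a\<leftarrow>w. 1 / real (d a)) \<le> 1"
    and "(\<Prod>a\<leftarrow>w. 1 / real (d a)) = 1 \<longleftrightarrow> (\<forall>a\<in>set w. d a = 1)"
    by (simp_all del: One_nat_def)
qed

text \<open>With \<open>N\<close> label words of common weight \<open>p\<close>, the entropy of a
  nonempty word is \<open>- N * p * log 2 p\<close>. As \<open>0 < p \<le> 1\<close>, this is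
  nonnegative and vanishes only for \<open>p = 1\<close>.\<close>

lemma fuzzy_entropy_le_0_iff:
  assumes FG: "uniformly_fuzzy0l_system FG" and w: "w \<in> lists (f_alph FG)"
  shows "fuzzy_entropy FG w \<le> 0 \<longleftrightarrow> (\<forall>a\<in>set w. degree_of FG a = 1)"
proof (cases "w = []")
  case False
  define p where "p = (\<Prod>a\<leftarrow>w. 1 / real (degree_of FG a))"
  have sys: "fuzzy0l_system FG"
    using FG by (simp add: uniformly_fuzzy0l_system_def)
  have pos: "degree_of FG a > 0" if "a \<in> set w" for a
    using degree_of_pos[OF sys] w that by auto
  then have "labels_of FG a \<noteq> {}" if "a \<in> set w" for a
    using that by (fastforce simp: degree_of_def)
  then have card: "card (label_words FG w) > 0"
    using label_words_nonempty label_words_finite sys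
    by (metis card_gt_0_iff fuzzy0l_system_def)
  have "(\<Sum>\<alpha>\<in>label_words FG w. mu_word FG \<alpha> * log 2 (mu_word FG \<alpha>))
      = real (card (label_words FG w)) * (p * log 2 p)"
    using mu_word_uniform[OF FG w] by (simp add: p_def)
  then have "fuzzy_entropy FG w \<le> 0 \<longleftrightarrow> 0 \<le> real (card (label_words FG w)) * (p * log 2 p)"
    using False by (simp add: fuzzy_entropy_def)
  also have "\<dots> \<longleftrightarrow> 0 \<le> log 2 p"
    using card prod_list_inverse_degree(1)[of w "degree_of FG", OF pos]
    by (simp add: p_def zero_le_mult_iff)
  also have "\<dots> \<longleftrightarrow> p = 1"
    using prod_list_inverse_degree(1,2)[of w "degree_of FG", OF pos] by (auto simp: p_def)
  also have "\<dots> \<longleftrightarrow> (\<forall>a\<in>set w. degree_of FG a = 1)"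
    using prod_list_inverse_degree(3)[of w "degree_of FG", OF pos] by (simp add: p_def)
  finally show ?thesis .
qed (simp add: fuzzy_entropy_def)

text \<open>Numbering the pairs \<open>(a, u)\<close> with \<open>u \<in> g a\<close> gives one
  label per production, and the constant grade 1 makes the weights uniform. Assumption
  \<open>out\<close> lets \<open>f_subst FG\<close> agree with \<open>g\<close> on all
  symbols.\<close>

lemma uniformly_fuzzy0l_system_of_substitution:
  assumes g: "finite_substitution A g" and s: "s \<in> lists A" and out: "\<And>a. a \<notin> A \<Longrightarrow> g a = {}"
  obtains FG :: "('a, nat) fuzzy0l"
  where "uniformly_fuzzy0l_system FG" "f_alph FG = A" "f_start FG = s" "f_subst FG = g"
    "\<And>a. degree_of FG a = card (g a)"
proof -
  define P where "P = Sigma A g"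
  have "finite P"
    using g by (auto simp: P_def finite_substitution_def)
  then obtain e where e: "bij_betw e {..<card P} P"
    using ex_bij_betw_nat_finite by (auto simp: atLeast0LessThan)
  define FG :: "('a, nat) fuzzy0l" where "FG =
    \<lparr>f_alph = A, f_prod = e, f_start = s, f_labels = {..<card P}, f_grade = \<lambda>_. 1\<rparr>"
  have img: "e ` {..<card P} = P"
    using e by (simp add: bij_betw_def)
  have inj: "inj_on e {..<card P}"
    using e by (simp add: bij_betw_def)
  have sub: "f_subst FG = g"
  proof
    fix a
    have "f_subst FG a = {u. (a, u) \<in> e ` {..<card P}}"
      by (force simp: f_subst_def FG_def)
    also have "\<dots> = g a"
      using out unfolding img by (auto simp: P_def)
    finally show "f_subst FG a = g a" .
  qed
  have deg: "degree_of FG a = card (g a)" for a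
  proof -
    \<comment> \<open>The labels of \<open>a\<close> correspond under \<open>e\<close> to the pairs
      with first component \<open>a\<close>, of which there are \<open>card (g a)\<close>.\<close>
    have "e ` labels_of FG a = {p \<in> e ` {..<card P}. fst p = a}"
      by (auto simp: labels_of_def FG_def)
    also have "\<dots> = Pair a ` g a"
      using out unfolding img by (auto simp: P_def)
    finally have "card (e ` labels_of FG a) = card (g a)"
      by (simp add: card_image inj_on_def)
    moreover have "inj_on e (labels_of FG a)"
      by (rule inj_on_subset[OF inj]) (auto simp: labels_of_def FG_def)
    ultimately show ?thesis
      by (simp add: degree_of_def card_image)
  qed
  have "card (g a) > 0" if "a \<in> A" for a
    using g that by (auto simp: finite_substitution_def card_gt_0_iff)
  moreover have "(\<Sum>r\<in>labels_of FG a. f_grade FG r) = real (degree_of FG a)" for a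
    by (simp add: FG_def degree_of_def)
  moreover have "fst (e r) \<in> A" if "r < card P" for r
  proof -
    have "e r \<in> P"
      using img that by auto
    then show ?thesis
      by (auto simp: P_def)
  qed
  ultimately have "fuzzy0l_system FG"
    using g s inj sub deg by (auto simp: fuzzy0l_system_def FG_def)
  moreover have "mu FG r = 1 / real (degree_of FG a)" if "r \<in> labels_of FG a" for a r
    using that by (simp add: mu_def labels_of_def degree_of_def FG_def)
  ultimately have "uniformly_fuzzy0l_system FG"
    by (simp add: uniformly_fuzzy0l_system_def)
  then show ?thesis
    using that sub deg by (simp add: FG_def)
qed

section \<open>The synchronized simulation\<close>

text \<open>The fresh symbols are parameters, so an infinite symbol type is required only to
  instantiate the locale.\<close>

locale synchronization =
  fixes G :: "'a e0l" and br :: "'a \<Rightarrow> 'a" and S F :: 'a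
  assumes G: "e0l_system G"
    and inj: "inj_on br (e_alph G)"
    and br: "a \<in> e_alph G \<Longrightarrow> br a \<notin> e_alph G \<and> br a \<noteq> S \<and> br a \<noteq> F"
    and SF: "S \<notin> e_alph G" "F \<notin> e_alph G" "S \<noteq> F"
begin

abbreviation "\<Sigma> \<equiv> e_alph G"
abbreviation "\<Delta> \<equiv> e_term G"
abbreviation "h \<equiv> e_subst G"
abbreviation "\<omega> \<equiv> e_start G"

text \<open>Right-hand sides for a symbol that simulates a letter with images \<open>U\<close>: the
  trap, coded words to continue, plain terminal words to switch.\<close>

definition images :: "'a list set \<Rightarrow> 'a list set" where
  "images U = insert [F] (map br ` U \<union> (U \<inter> lists \<Delta>))"

text \<open>The second image \<open>[F, F]\<close> gives the trap degree 2; with \<open>[F]\<close>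
  alone, trapped words would have entropy 0. \<open>S\<close> acts like the copy of a letter whose
  only image is \<open>\<omega>\<close>.\<close>

definition g :: "'a \<Rightarrow> 'a list set" where
  "g x = (if x = F then {[F], [F, F]}
          else if x = S then images {\<omega>}
          else if x \<in> \<Delta> then {[F]}
          else if x \<in> br ` \<Sigma> then images (h (inv_into \<Sigma> br x))
          else {})"

definition alph :: "'a set" where
  "alph = insert F (insert S (\<Delta> \<union> br ` \<Sigma>))"

lemma \<Delta>: "\<Delta> \<subseteq> \<Sigma>" and h: "finite_substitution \<Sigma> h" and \<omega>: "\<omega> \<in> lists \<Sigma>"
  using G by (auto simp: e0l_system_def)

lemma g_F: "g F = {[F], [F, F]}"
  by (simp add: g_def)

lemma g_S: "g S = images {\<omega>}"
  using SF by (simp add: g_def)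

lemma g_term: "a \<in> \<Delta> \<Longrightarrow> g a = {[F]}"
  using SF \<Delta> by (auto simp: g_def)

lemma g_br: "a \<in> \<Sigma> \<Longrightarrow> g (br a) = images (h a)"
  using br[of a] \<Delta> inj by (auto simp: g_def inv_into_f_f)

lemma g_outside: "a \<notin> alph \<Longrightarrow> g a = {}"
  by (auto simp: g_def alph_def)

section \<open>Alphabet and degrees of the simulating substitution\<close>

lemma images_finite: "finite U \<Longrightarrow> finite (images U)"
  by (simp add: images_def)

lemma images_alph: "U \<subseteq> lists \<Sigma> \<Longrightarrow> images U \<subseteq> lists alph"
  unfolding images_def alph_def by fastforce

text \<open>No copy equals \<open>F\<close>, so \<open>[F]\<close> and \<open>map br u\<close> are
  distinct members, also for empty \<open>u\<close>.\<close>

lemma card_images: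
  assumes "finite U" "U \<noteq> {}" "U \<subseteq> lists \<Sigma>"
  shows "card (images U) \<ge> 2"
proof -
  obtain u where u: "u \<in> U"
    using assms(2) by blast
  then have "u \<in> lists \<Sigma>"
    using assms(3) by blast
  then have "map br u \<noteq> [F]"
    using br by (auto simp: eq_commute[of F])
  then have "card {[F], map br u} = 2"
    by (auto simp: card_insert_if)
  moreover have "{[F], map br u} \<subseteq> images U"
    using u by (auto simp: images_def)
  ultimately show ?thesis
    using images_finite[OF assms(1)] card_mono by metis
qed

lemma h_letter:
  assumes "a \<in> \<Sigma>"
  shows "finite (h a)" "h a \<noteq> {}" "h a \<subseteq> lists \<Sigma>"
  using assms h by (auto simp: finite_substitution_def)

lemma finite_substitution_g: "finite_substitution alph g"
proof -
  have "finite (g x) \<and> g x \<noteq> {} \<and> g x \<subseteq> lists alph" if x: "x \<in> alph" for x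
  proof -
    have ne: "images U \<noteq> {}" for U
      by (simp add: images_def)
    consider "x = F" | "x = S" | "x \<in> \<Delta>" | a where "a \<in> \<Sigma>" "x = br a"
      using x unfolding alph_def by blast
    then show ?thesis
    proof cases
      case 4
      then show ?thesis
        using ne h_letter images_finite images_alph g_br by metis
    qed (use \<omega> images_alph[of "{\<omega>}"] images_finite[of "{\<omega>}"] ne in
        \<open>auto simp: g_F g_S g_term alph_def\<close>)
  qed
  moreover have "finite alph"
    using h \<Delta> by (auto simp: alph_def finite_substitution_def intro: finite_subset)
  ultimately show ?thesis
    by (simp add: finite_substitution_def)
qed

text \<open>Translates the degree condition of the entropy criterion into membership in
  \<open>\<Delta>\<close>: the trap has two images, and \<open>card_images\<close> handles
  \<open>S\<close> and the copies.\<close>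

lemma card_g_eq_1_iff:
  assumes "x \<in> alph"
  shows "card (g x) = 1 \<longleftrightarrow> x \<in> \<Delta>"
proof -
  consider "x = F" | "x = S" | "x \<in> \<Delta>" | a where "a \<in> \<Sigma>" "x = br a"
    using assms unfolding alph_def by blast
  then show ?thesis
  proof cases
    case 1
    then show ?thesis
      using SF \<Delta> by (auto simp: g_F)
  next
    case 2
    then show ?thesis
      using SF \<Delta> \<omega> card_images[of "{\<omega>}"] by (auto simp: g_S)
  next
    case 3
    then show ?thesis
      by (simp add: g_term)
  next
    case (4 a)
    then have "card (g x) \<ge> 2"
      using card_images[OF h_letter] g_br by simp
    then show ?thesis
      using 4 br \<Delta> by auto
  qed
qed

section \<open>Completeness and soundness of the simulation\<close>

lemma subst_word_g_map_br:
  assumes "v \<in> lists \<Sigma>" "u \<in> subst_word h v"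
  shows "map br u \<in> subst_word g (map br v)"
    and "u \<in> lists \<Delta> \<Longrightarrow> u \<in> subst_word g (map br v)"
proof -
  \<comment> \<open>One induction follows both modes: all letters take coded images, or all take
    plain terminal ones.\<close>
  have "map br u \<in> subst_word g (map br v) \<and> (u \<in> lists \<Delta> \<longrightarrow> u \<in> subst_word g (map br v))"
    using assms
  proof (induction v arbitrary: u rule: list.induct)
    case (Cons a v)
    then obtain x y where xy: "u = x @ y" "x \<in> h a" "y \<in> subst_word h v"
      by (auto simp: subst_word_Cons)
    moreover have "g (br a) = images (h a)"
      using Cons.prems(1) g_br by simp
    then have "map br x \<in> g (br a)" "x \<in> lists \<Delta> \<Longrightarrow> x \<in> g (br a)"
      using xy(2) unfolding images_def by blast+
    moreover have "map br y \<in> subst_word g (map br v)"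
      "y \<in> lists \<Delta> \<Longrightarrow> y \<in> subst_word g (map br v)"
      using Cons xy(3) by auto
    ultimately show ?case
      by (auto simp: subst_word_Cons)
  qed simp
  then show "map br u \<in> subst_word g (map br v)"
    and "u \<in> lists \<Delta> \<Longrightarrow> u \<in> subst_word g (map br v)"
    by blast+
qed

text \<open>The coded word carries the induction; the plain one is reached from the coded
  predecessor by switching in the last step.\<close>

lemma derivable_g_complete:
  assumes "v \<in> derivable h \<omega>"
  shows "map br v \<in> derivable g [S] \<and> (v \<in> lists \<Delta> \<longrightarrow> v \<in> derivable g [S])"
  using assms
proof (induction rule: derivable_induct)
  case refl
  \<comment> \<open>The step out of \<open>S\<close> stands for zero steps of \<open>G\<close>, so a
    terminal \<open>\<omega>\<close> must be reachable here as well.\<close>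
  have "map br \<omega> \<in> subst_word g [S]" "\<omega> \<in> lists \<Delta> \<Longrightarrow> \<omega> \<in> subst_word g [S]"
    by (auto simp: g_S images_def)
  then show ?case
    using derivable_step[OF derivable_refl] by metis
next
  case (step v u)
  then show ?case
    using subst_word_g_map_br[of v u] derivable_in_lists[OF h \<omega>] derivable_step by metis
qed

text \<open>Letters choose their mode independently, so the soundness invariant must admit words
  mixing copies and plain terminals.\<close>

definition covers :: "'a list \<Rightarrow> 'a list \<Rightarrow> bool" where
  "covers = list_all2 (\<lambda>a b. b = br a \<or> b = a \<and> a \<in> \<Delta>)"

lemma images_covers:
  assumes "y \<in> images U"
  shows "F \<in> set y \<or> (\<exists>u\<in>U. covers u y)"
proof -
  have "covers u (map br u)" for u
    by (simp add: covers_def list_all2_map2 list.rel_refl_strong)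
  moreover have "covers u u" if "u \<in> lists \<Delta>" for u
    unfolding covers_def using that by (intro list.rel_refl_strong) auto
  ultimately show ?thesis
    using assms unfolding images_def by auto
qed

text \<open>If no block of \<open>y\<close> contains \<open>F\<close>, each block is covered by an
  image under \<open>h\<close> of the corresponding letter of \<open>v\<close>, and these images
  concatenate to a successor of \<open>v\<close>.\<close>

lemma subst_word_g_covers:
  assumes "covers v x" "v \<in> lists \<Sigma>" "y \<in> subst_word g x"
  shows "F \<in> set y \<or> (\<exists>u\<in>subst_word h v. covers u y)"
  using assms(1)[unfolded covers_def] assms(2,3)
proof (induction arbitrary: y rule: list_all2_induct)
  case Nil
  then show ?case
    by (simp add: covers_def)
next
  case (Cons a v b x)
  obtain s t where st: "y = s @ t" "s \<in> g b" "t \<in> subst_word g x"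
    using Cons.prems by (auto simp: subst_word_Cons)
  have "F \<in> set s \<or> (\<exists>u\<in>h a. covers u s)"
  proof (cases "b = br a")
    case True
    then show ?thesis
      using Cons.prems st(2) g_br images_covers by auto
  next
    \<comment> \<open>The letter has already switched: \<open>b = a \<in> \<Delta>\<close>, and its
      only image is \<open>[F]\<close>.\<close>
    case False
    then show ?thesis
      using Cons.hyps st(2) g_term by auto
  qed
  moreover have "F \<in> set t \<or> (\<exists>u\<in>subst_word h v. covers u t)"
    using Cons st(3) by auto
  ultimately show ?case
    unfolding st(1) subst_word_Cons covers_def by (fastforce intro: list_all2_appendI)
qed

lemma subst_word_g_trap:
  assumes "F \<in> set x" "y \<in> subst_word g x"
  shows "F \<in> set y"
  using assms by (induction x arbitrary: y) (auto simp: subst_word_Cons g_F)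

text \<open>Invariant with three phases: not yet started, trapped for good, or simulating some word
  derivable in \<open>G\<close>.\<close>

lemma derivable_g_sound:
  assumes "x \<in> derivable g [S]"
  shows "x = [S] \<or> F \<in> set x \<or> (\<exists>v\<in>derivable h \<omega>. covers v x)"
  using assms
proof (induction rule: derivable_induct)
  case (step x y)
  then consider "x = [S]" | "F \<in> set x" | v where "v \<in> derivable h \<omega>" "covers v x"
    by blast
  then show ?case
  proof cases
    case 1
    then show ?thesis
      using step.hyps images_covers[of y "{\<omega>}"] derivable_refl by (auto simp: g_S)
  next
    case 2
    then show ?thesis
      using step.hyps subst_word_g_trap by blast
  next
    case (3 v)
    then show ?thesis
      using step.hyps subst_word_g_covers[of v x y] derivable_in_lists[OF h \<omega>] derivable_step
      by metis
  qed
qed simp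

text \<open>Copies lie outside \<open>\<Sigma>\<close>, hence outside \<open>\<Delta>\<close>, so
  every position of \<open>x\<close> is plain.\<close>

lemma covers_term:
  assumes "covers v x" "v \<in> lists \<Sigma>" "x \<in> lists \<Delta>"
  shows "v = x"
  using assms(1)[unfolded covers_def] assms(2,3)
proof (induction rule: list_all2_induct)
  case (Cons a v b x)
  then show ?case
    using br \<Delta> by auto
qed simp

lemma derivable_g_term: "derivable g [S] \<inter> lists \<Delta> = e0l_lang G"
proof
  show "e0l_lang G \<subseteq> derivable g [S] \<inter> lists \<Delta>"
    using derivable_g_complete by (auto simp: e0l_lang_def)
  show "derivable g [S] \<inter> lists \<Delta> \<subseteq> e0l_lang G"
  proof
    fix x assume x: "x \<in> derivable g [S] \<inter> lists \<Delta>"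
    \<comment> \<open>Neither \<open>S\<close> nor \<open>F\<close> is a terminal, so only the third
      phase of the invariant remains.\<close>
    then have "x \<noteq> [S]" "F \<notin> set x"
      using SF \<Delta> by auto
    then obtain v where v: "v \<in> derivable h \<omega>" "covers v x"
      using derivable_g_sound x by blast
    then have "v = x"
      using x covers_term derivable_in_lists[OF h \<omega>] by blast
    then show "x \<in> e0l_lang G"
      using v x by (simp add: e0l_lang_def)
  qed
qed

lemma ex_uniformly_fuzzy0l_system:
  "\<exists>FG :: ('a, nat) fuzzy0l.
    uniformly_fuzzy0l_system FG \<and> e0l_lang G = bounded_entropy_lang FG 0"
proof -
  have S: "[S] \<in> lists alph"
    by (simp add: alph_def)
  obtain FG :: "('a, nat) fuzzy0l" where FG: "uniformly_fuzzy0l_system FG" "f_alph FG = alph"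
    "f_start FG = [S]" "f_subst FG = g" "\<And>a. degree_of FG a = card (g a)"
    using uniformly_fuzzy0l_system_of_substitution[OF finite_substitution_g S g_outside] by blast
  have "fuzzy_entropy FG w \<le> 0 \<longleftrightarrow> w \<in> lists \<Delta>" if "w \<in> derivable g [S]" for w
  proof -
    have "w \<in> lists alph"
      using derivable_in_lists[OF finite_substitution_g S that] .
    moreover from this have "fuzzy_entropy FG w \<le> 0 \<longleftrightarrow> (\<forall>a\<in>set w. card (g a) = 1)"
      using fuzzy_entropy_le_0_iff[OF FG(1)] FG by simp
    ultimately show ?thesis
      using card_g_eq_1_iff by auto
  qed
  then have "bounded_entropy_lang FG 0 = derivable g [S] \<inter> lists \<Delta>"
    using FG by (auto simp: bounded_entropy_lang_def)
  then show ?thesis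
    using FG(1) derivable_g_term by metis
qed

end

section \<open>Supply of fresh symbols and conclusion\<close>

lemma ex_synchronization:
  fixes G :: "('a::infinite) e0l"
  assumes "e0l_system G"
  shows "\<exists>br S F. synchronization G br S F"
proof -
  have fin: "finite (e_alph G)"
    using assms by (simp add: e0l_system_def finite_substitution_def)
  then obtain num :: "'a \<Rightarrow> nat" where num: "inj_on num (e_alph G)"
    using finite_imp_inj_to_nat_seg by metis
  have "infinite (- e_alph G)"
    using fin infinite_UNIV by (simp add: Compl_eq_Diff_UNIV)
  then obtain e :: "nat \<Rightarrow> 'a" where e: "inj e" "range e \<subseteq> - e_alph G"
    using infinite_countable_subset by blast
  \<comment> \<open>The sequence \<open>e\<close> enumerates distinct symbols outside the alphabet.
    Its entries 0 and 1 serve as \<open>S\<close> and \<open>F\<close>, hence the shift by 2 for the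
    copies.\<close>
  have "synchronization G (\<lambda>a. e (num a + 2)) (e 0) (e 1)"
  proof
    have "e n \<notin> e_alph G" for n
      using e(2) by blast
    then show "e (num a + 2) \<notin> e_alph G \<and> e (num a + 2) \<noteq> e 0 \<and> e (num a + 2) \<noteq> e 1"
      and "e 0 \<notin> e_alph G" "e 1 \<notin> e_alph G" "e 0 \<noteq> e 1" for a
      using e(1) by (simp_all add: inj_eq)
    show "inj_on (\<lambda>a. e (num a + 2)) (e_alph G)"
      using num by (simp add: inj_on_def inj_eq[OF e(1)])
  qed (rule assms)
  then show ?thesis
    by blast
qed

theorem theorem3:
  shows "(\<forall>G :: ('a::infinite) e0l. e0l_system G \<longrightarrow>
            (\<exists>FG :: ('a, nat) fuzzy0l.
               uniformly_fuzzy0l_system FG \<and> e0l_lang G = bounded_entropy_lang FG 0))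
         \<and> (E0L :: 'a list set set) \<subseteq> BFEL"
proof -
  have main: "\<exists>FG :: ('a, nat) fuzzy0l.
      uniformly_fuzzy0l_system FG \<and> e0l_lang G = bounded_entropy_lang FG 0"
    if G: "e0l_system G" for G :: "'a e0l"
  proof -
    obtain br S F where "synchronization G br S F"
      using ex_synchronization[OF G] by blast
    then show ?thesis
      by (rule synchronization.ex_uniformly_fuzzy0l_system)
  qed
  have "(E0L :: 'a list set set) \<subseteq> BFEL"
  proof
    fix L :: "'a list set" assume "L \<in> E0L"
    then obtain G where "L = e0l_lang G" "e0l_system G"
      unfolding E0L_def by blast
    with main obtain FG :: "('a, nat) fuzzy0l"
      where "L = bounded_entropy_lang FG 0" "fuzzy0l_system FG"
      unfolding uniformly_fuzzy0l_system_def by metis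
    then show "L \<in> BFEL"
      \<comment> \<open>The bound is \<open>c = 0\<close>; \<open>order_refl\<close> gives its
        nonnegativity.\<close>
      unfolding BFEL_def using order_refl by blast
  qed
  with main show ?thesis
    by blast
qed

end
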